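(* Let $(J,\mathcal{A})$ be a standard Borel space, $\psi$ a finite nonnegative measure on $\mathcal{A}\times\mathcal{A}$, and $\sigma,\tau$ finite nonnegative measures on $\mathcal{A}$ with $\sigma(J)=\tau(J)$. There is a $\sigma$-$\tau$ flow $\varphi$ with $\varphi\le\psi$ if and only if $\psi(S\times S^c)\ge\sigma(S)-\tau(S)$ for every $S\in\mathcal{A}$.
   Context: A $\sigma$-$\tau$ flow is a finite nonnegative measure $\varphi$ on $\mathcal{A}\times\mathcal{A}$ with $\varphi^1-\varphi^2=\sigma-\tau$, where $\varphi^1(A)=\varphi(A\times J)$ and $\varphi^2(A)=\varphi(J\times A)$. $S^c=J\setminus S$; $\varphi\le\psi$ is setwise. *)

theory Defs
  imports "HOL-Analysis.Analysis"
begin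

text \<open>A measurable space is represented by a value of type \<^typ>\<open>'a measure\<close> of which only
  the space and the sets are used; its own measure plays no role.\<close>

definition standard_borel :: "'a measure \<Rightarrow> bool" where
  "standard_borel J \<longleftrightarrow>
     (\<exists>T. completely_metrizable_space T \<and> separable_space T \<and>
          topspace T = space J \<and> sets J = sigma_sets (topspace T) {U. openin T U})"

definition finite_measure_on :: "'a measure \<Rightarrow> 'a measure \<Rightarrow> bool" where
  "finite_measure_on J \<mu> \<longleftrightarrow> sets \<mu> = sets J \<and> finite_measure \<mu>"

definition marginal1 :: "'a measure \<Rightarrow> ('a \<times> 'a) measure \<Rightarrow> 'a set \<Rightarrow> real" where
  "marginal1 J \<phi> A = measure \<phi> (A \<times> space J)"

definition marginal2 :: "'a measure \<Rightarrow> ('a \<times> 'a) measure \<Rightarrow> 'a set \<Rightarrow> real" where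
  "marginal2 J \<phi> A = measure \<phi> (space J \<times> A)"

text \<open>The flow condition is an identity of signed measures, hence stated setwise with
  real values.\<close>

definition is_flow ::
  "'a measure \<Rightarrow> 'a measure \<Rightarrow> 'a measure \<Rightarrow> ('a \<times> 'a) measure \<Rightarrow> bool" where
  "is_flow J \<sigma> \<tau> \<phi> \<longleftrightarrow>
     finite_measure_on (J \<Otimes>\<^sub>M J) \<phi> \<and>
     (\<forall>A\<in>sets J. marginal1 J \<phi> A - marginal2 J \<phi> A = measure \<sigma> A - measure \<tau> A)"

end

theory Submission
  imports Defs
begin

text \<open>Additive set functions \<open>f\<close> with \<open>0 \<le> f \<le> \<psi>\<close> form a compact set in the product topology, and each
  marginal condition is closed. By the finite intersection property it suffices to satisfy
  finitely many marginal conditions at once, which is the finite max-flow min-cut theorem on the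
  atoms of a finite family of sets. Since \<open>\<psi>\<close> is countably additive and finite, every additive
  \<open>f \<le> \<psi>\<close> is a measure.\<close>

section \<open>Compact boxes in the product topology\<close>

lemma compact_box_fun:
  fixes c :: "'e \<Rightarrow> real"
  shows "compact {f. \<forall>e. 0 \<le> f e \<and> f e \<le> c e}"
proof -
  \<comment> \<open>Tychonoff's theorem for a product of compact intervals.\<close>
  have "compactin (product_topology (\<lambda>_. euclidean) UNIV) (PiE UNIV (\<lambda>e. {0..c e}))"
    by (simp add: compactin_PiE)
  moreover have "PiE UNIV (\<lambda>e. {0..c e}) = {f. \<forall>e. 0 \<le> f e \<and> f e \<le> c e}"
    by (auto simp: PiE_UNIV_domain)
  ultimately show ?thesis
    by (simp add: euclidean_product_topology)
qed

lemma continuous_on_fun_apply: "continuous_on S (\<lambda>f. f x)"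
  by (rule continuous_on_subset[OF continuous_on_product_coordinates]) simp

section \<open>Feasible flows in finite networks\<close>

text \<open>Edges inside \<open>S\<close> enter the sum once with each sign and cancel, so only
  edges crossing the boundary of \<open>S\<close> contribute.\<close>

lemma sum_net_eq_cut:
  fixes f :: "'v \<Rightarrow> 'v \<Rightarrow> real"
  assumes "finite V" "S \<subseteq> V"
  shows "(\<Sum>x\<in>S. \<Sum>w\<in>V. f x w - f w x) = (\<Sum>x\<in>S. \<Sum>w\<in>V - S. f x w - f w x)"
proof -
  have "(\<Sum>x\<in>S. \<Sum>w\<in>S. f x w - f w x) = 0"
    by (simp add: sum_subtractf sum.swap[of "\<lambda>x w. f w x" S S])
  then show ?thesis
    by (simp add: sum.subset_diff[OF assms(2,1)] sum.distrib)
qed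

text \<open>Models pushing \<open>d\<close> more units from \<open>u\<close> to \<open>v\<close>,
  which moves \<open>d\<close> of excess from \<open>u\<close> to \<open>v\<close>. The sum of
  squares drops exactly when \<open>d\<close> lies strictly between 0 and
  \<open>p u - p v\<close>.\<close>

lemma sum_squares_transfer:
  fixes p :: "'v \<Rightarrow> real"
  assumes "finite V" "u \<in> V" "v \<in> V" "u \<noteq> v"
  shows "(\<Sum>x\<in>V. (p x - (if x = u then d else 0) + (if x = v then d else 0))\<^sup>2)
    = (\<Sum>x\<in>V. (p x)\<^sup>2) + 2 * d * (d - (p u - p v))"
proof -
  have "(p x - (if x = u then d else 0) + (if x = v then d else 0))\<^sup>2
      = (p x)\<^sup>2 + (if x = u then d\<^sup>2 - 2 * d * p x else 0) + (if x = v then d\<^sup>2 + 2 * d * p x else 0)" for x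
    using assms(4) by (auto simp: power2_eq_square algebra_simps)
  then show ?thesis
    using assms by (simp add: sum.distrib) (simp add: power2_eq_square algebra_simps)
qed

text \<open>At a minimiser of the sum of squared excesses, no small change along an edge helps. Hence
  every edge is saturated if it leads from higher to lower excess, and empty in the opposite
  case, so the set of vertices with positive excess is a cut that violates the hypothesis.\<close>

lemma finite_feasible_flow:
  fixes c :: "'v \<Rightarrow> 'v \<Rightarrow> real" and s :: "'v \<Rightarrow> real"
  assumes fin: "finite V" and c: "\<And>u v. 0 \<le> c u v" and s0: "sum s V = 0"
    and cut: "\<And>S. S \<subseteq> V \<Longrightarrow> sum s S \<le> (\<Sum>u\<in>S. \<Sum>v\<in>V - S. c u v)"
  obtains f where "\<And>u v. 0 \<le> f u v" "\<And>u v. f u v \<le> c u v"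
    "\<And>v. v \<in> V \<Longrightarrow> (\<Sum>w\<in>V. f v w - f w v) = s v"
proof -
  define B where "B = {f. \<forall>e. 0 \<le> f e \<and> f e \<le> c (fst e) (snd e)}"
  \<comment> \<open>The supply at \<open>x\<close> that \<open>f\<close> does not yet carry away;
    \<open>f\<close> solves the problem iff \<open>ex f\<close> vanishes on
    \<open>V\<close>.\<close>
  define ex where "ex f x = s x - (\<Sum>w\<in>V. f (x, w) - f (w, x))" for f :: "'v \<times> 'v \<Rightarrow> real" and x
  have "compact B"
    unfolding B_def by (rule compact_box_fun)
  moreover have "B \<noteq> {}"
    unfolding B_def using c by (auto intro!: exI[of _ "\<lambda>_. 0"])
  moreover have "continuous_on B (\<lambda>f. \<Sum>x\<in>V. (ex f x)\<^sup>2)"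
    unfolding ex_def by (intro continuous_intros continuous_on_fun_apply)
  ultimately obtain f where f: "f \<in> B"
    and min: "\<And>g. g \<in> B \<Longrightarrow> (\<Sum>x\<in>V. (ex f x)\<^sup>2) \<le> (\<Sum>x\<in>V. (ex g x)\<^sup>2)"
    using continuous_attains_inf[of B "\<lambda>f. \<Sum>x\<in>V. (ex f x)\<^sup>2"] by blast
  have f0: "0 \<le> f (u, v)" and fc: "f (u, v) \<le> c u v" for u v
    using f by (auto simp: B_def)
  define p where "p = ex f"
  have opt: "0 \<le> d * (d - (p u - p v))"
    if uv: "u \<in> V" "v \<in> V" "u \<noteq> v" and d: "0 \<le> f (u, v) + d" "f (u, v) + d \<le> c u v" for u v d
  proof -
    define g where "g e = f e + (if e = (u, v) then d else 0)" for e
    have "g \<in> B"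
      using f d by (auto simp: B_def g_def)
    have "ex g x = p x - (if x = u then d else 0) + (if x = v then d else 0)" for x
    proof -
      have "(\<Sum>w\<in>V. g (x, w)) = (\<Sum>w\<in>V. f (x, w)) + (if x = u then d else 0)"
        using fin uv by (auto simp: g_def sum.distrib)
      moreover have "(\<Sum>w\<in>V. g (w, x)) = (\<Sum>w\<in>V. f (w, x)) + (if x = v then d else 0)"
        using fin uv by (auto simp: g_def sum.distrib)
      ultimately show ?thesis
        by (simp add: p_def ex_def sum_subtractf)
    qed
    with min[OF \<open>g \<in> B\<close>] sum_squares_transfer[OF fin uv, of p d] show ?thesis
      by (simp add: p_def mult.assoc)
  qed
  have saturated: "f (u, v) = c u v" if uv: "u \<in> V" "v \<in> V" "p v < p u" for u v
  proof (rule ccontr)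
    assume "f (u, v) \<noteq> c u v"
    \<comment> \<open>Bounded by the residual capacity, so that the change is admissible; the half
      keeps \<open>d\<close> strictly below \<open>p u - p v\<close>, so that the change is an
      improvement.\<close>
    define d where "d = min (c u v - f (u, v)) ((p u - p v) / 2)"
    have d: "0 < d" "d < p u - p v" "f (u, v) + d \<le> c u v"
      using fc[of u v] uv \<open>f (u, v) \<noteq> c u v\<close> by (auto simp: d_def min_def field_simps)
    then have "d * (d - (p u - p v)) < 0"
      by (intro mult_pos_neg) auto
    moreover have "0 \<le> d * (d - (p u - p v))"
      using uv d f0[of u v] by (intro opt) auto
    ultimately show False by simp
  qed
  have vanishing: "f (u, v) = 0" if uv: "u \<in> V" "v \<in> V" "p u < p v" for u v
  proof (rule ccontr)
    assume "f (u, v) \<noteq> 0"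
    \<comment> \<open>The mirror image: a negative \<open>d\<close> withdraws flow, at most all of
      it.\<close>
    define d where "d = max (- f (u, v)) ((p u - p v) / 2)"
    have d: "d < 0" "p u - p v < d" "0 \<le> f (u, v) + d"
      using f0[of u v] uv \<open>f (u, v) \<noteq> 0\<close> by (auto simp: d_def max_def field_simps)
    then have "d * (d - (p u - p v)) < 0"
      by (intro mult_neg_pos) auto
    moreover have "0 \<le> d * (d - (p u - p v))"
      using uv d fc[of u v] by (intro opt) auto
    ultimately show False by simp
  qed
  have sum_p: "sum p S = sum s S - (\<Sum>x\<in>S. \<Sum>w\<in>V - S. f (x, w) - f (w, x))" if "S \<subseteq> V" for S
    using sum_net_eq_cut[OF fin that, of "\<lambda>x w. f (x, w)"]
    by (simp add: p_def ex_def sum_subtractf)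
  define S where "S = {v \<in> V. 0 < p v}"
  have S: "S \<subseteq> V" "finite S"
    using fin by (auto simp: S_def)
  \<comment> \<open>Excess is positive on \<open>S\<close> and nonpositive off it, so edges leaving
    \<open>S\<close> are saturated and edges entering \<open>S\<close> are empty.\<close>
  have "(\<Sum>x\<in>S. \<Sum>w\<in>V - S. f (x, w) - f (w, x)) = (\<Sum>x\<in>S. \<Sum>w\<in>V - S. c x w)"
    by (intro sum.cong refl) (auto simp: S_def saturated vanishing)
  then have "sum p S \<le> 0"
    using sum_p[OF S(1)] cut[OF S(1)] by simp
  moreover have "0 < sum p S" if "S \<noteq> {}"
    using that S by (intro sum_pos) (auto simp: S_def)
  ultimately have "S = {}" by fastforce
  then have nonpos: "p v \<le> 0" if "v \<in> V" for v
    using that by (force simp: S_def)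
  \<comment> \<open>The whole of \<open>V\<close> has no boundary edges, so the total excess equals
    the total supply 0. Nonpositive terms with sum 0 all vanish.\<close>
  have "(\<Sum>v\<in>V. - p v) = 0"
    using sum_p[of V] s0 by (simp add: sum_negf)
  then have "p v = 0" if "v \<in> V" for v
    using sum_nonneg_eq_0_iff[of V "\<lambda>v. - p v"] fin nonpos that by auto
  then show thesis
    using f0 fc by (intro that[of "\<lambda>u v. f (u, v)"]) (auto simp: p_def ex_def)
qed

section \<open>Grids of rectangles and atoms of a finite family\<close>

text \<open>Finite additivity over the disjoint cells of a grid. The set \<open>X\<close> makes this
  usable both for a union of cells and for an arbitrary measurable set cut up by the grid.\<close>

lemma measure_UN_times_UN:
  assumes "finite_measure M" and sets_M: "sets M = sets (J \<Otimes>\<^sub>M K)"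
    and fin: "finite S" "finite T"
    and meas: "\<And>u. u \<in> S \<Longrightarrow> A u \<in> sets J" "\<And>v. v \<in> T \<Longrightarrow> B v \<in> sets K"
    and disj: "disjoint_family_on A S" "disjoint_family_on B T"
    and X: "X \<in> sets M"
  shows "measure M (X \<inter> (\<Union>u\<in>S. A u) \<times> (\<Union>v\<in>T. B v)) = (\<Sum>u\<in>S. \<Sum>v\<in>T. measure M (X \<inter> A u \<times> B v))"
proof -
  interpret finite_measure M by fact
  have "measure M (\<Union>(u, v)\<in>S \<times> T. X \<inter> A u \<times> B v)
      = (\<Sum>(u, v)\<in>S \<times> T. measure M (X \<inter> A u \<times> B v))"
  proof (subst finite_measure_finite_Union)
    show "(\<lambda>(u, v). X \<inter> A u \<times> B v) ` (S \<times> T) \<subseteq> sets M"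
      using meas X by (auto simp: sets_M)
    show "disjoint_family_on (\<lambda>(u, v). X \<inter> A u \<times> B v) (S \<times> T)"
      using disj unfolding disjoint_family_on_def by fastforce
  qed (use fin in \<open>auto intro!: sum.cong\<close>)
  moreover have "(\<Union>(u, v)\<in>S \<times> T. X \<inter> A u \<times> B v) = X \<inter> (\<Union>u\<in>S. A u) \<times> (\<Union>v\<in>T. B v)"
    by auto
  ultimately show ?thesis
    by (simp add: sum.cartesian_product)
qed

text \<open>An atom is indexed by the subfamily of \<open>F\<close> whose members contain its
  points. Some indices give the empty set; the index \<open>{}\<close> gives the part of the space
  that \<open>F\<close> leaves uncovered.\<close>

definition atom_of :: "'a measure \<Rightarrow> 'a set set \<Rightarrow> 'a set set \<Rightarrow> 'a set" where
  "atom_of J F v = {x \<in> space J. v = {A \<in> F. x \<in> A}}"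

lemma mem_atom_of: "x \<in> atom_of J F v \<longleftrightarrow> x \<in> space J \<and> v = {A \<in> F. x \<in> A}"
  by (simp add: atom_of_def)

lemma disjoint_family_atom_of: "disjoint_family_on (atom_of J F) V"
  by (auto simp: disjoint_family_on_def atom_of_def)

lemma atom_of_sets:
  assumes "finite F" "F \<subseteq> sets J" "v \<subseteq> F"
  shows "atom_of J F v \<in> sets J"
proof -
  have "atom_of J F v = {x \<in> space J. \<forall>A\<in>F. x \<in> A \<longleftrightarrow> A \<in> v}"
    using assms(3) by (auto simp: atom_of_def)
  also have "\<dots> \<in> sets J"
  proof (rule sets.sets_Collect_finite_All[OF _ assms(1)])
    fix A assume "A \<in> F"
    then have "A \<in> sets J" using assms(2) by auto
    then have "{x \<in> space J. x \<in> A} \<in> sets J" "{x \<in> space J. x \<notin> A} \<in> sets J"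
      by measurable
    then show "{x \<in> space J. x \<in> A \<longleftrightarrow> A \<in> v} \<in> sets J"
      by (cases "A \<in> v") simp_all
  qed
  finally show ?thesis .
qed

lemma UN_atom_of: "(\<Union>v\<in>Pow F. atom_of J F v) = space J"
  by (rule set_eqI) (simp add: mem_atom_of)

lemma UN_atom_of_eq:
  assumes "A \<in> F" "A \<subseteq> space J"
  shows "(\<Union>v\<in>{v \<in> Pow F. A \<in> v}. atom_of J F v) = A"
  using assms by (auto simp: mem_atom_of)

section \<open>Solving finitely many marginal conditions\<close>

text \<open>Only finite additivity: each instance involves three coordinates of \<open>f\<close>,
  hence is a closed condition in the product topology.\<close>

definition set_additive :: "'b measure \<Rightarrow> ('b set \<Rightarrow> real) \<Rightarrow> bool" where
  "set_additive M f \<longleftrightarrow> (\<forall>X\<in>sets M. \<forall>Y\<in>sets M. X \<inter> Y = {} \<longrightarrow> f (X \<union> Y) = f X + f Y)"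

text \<open>On the atoms of a finite family the problem is a finite flow problem; inside each product
  of two atoms the flow value is spread proportionally to \<open>\<psi>\<close>. Where \<open>\<psi>\<close> vanishes the quotient is
  the junk value 0, which is harmless as the flow value is 0 as well.\<close>

lemma flow_on_finite_family:
  assumes \<psi>: "finite_measure \<psi>" "sets \<psi> = sets (J \<Otimes>\<^sub>M J)"
    and \<sigma>: "finite_measure \<sigma>" "sets \<sigma> = sets J"
    and \<tau>: "finite_measure \<tau>" "sets \<tau> = sets J"
    and total: "measure \<sigma> (space J) = measure \<tau> (space J)"
    and cut: "\<And>S. S \<in> sets J \<Longrightarrow> measure \<sigma> S - measure \<tau> S \<le> measure \<psi> (S \<times> (space J - S))"
    and F: "finite F" "F \<subseteq> sets J"
  obtains \<phi> where "\<And>X. 0 \<le> \<phi> X" "\<And>X. \<phi> X \<le> measure \<psi> X" "set_additive \<psi> \<phi>"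
    "\<And>A. A \<in> F \<Longrightarrow> \<phi> (A \<times> space J) - \<phi> (space J \<times> A) = measure \<sigma> A - measure \<tau> A"
proof -
  interpret \<psi>: finite_measure \<psi> by fact
  interpret \<sigma>: finite_measure \<sigma> by fact
  interpret \<tau>: finite_measure \<tau> by fact
  define V where "V = Pow F"
  define C where "C = atom_of J F"
  have finV: "finite V" using F by (simp add: V_def)
  have C_sets: "C v \<in> sets J" if "v \<in> V" for v
    using that atom_of_sets[OF F] by (simp add: C_def V_def)
  have disj: "disjoint_family_on C T" for T
    unfolding C_def by (rule disjoint_family_atom_of)
  have UN_V: "(\<Union>v\<in>V. C v) = space J"
    by (simp only: V_def C_def UN_atom_of)
  \<comment> \<open>The finite network: vertices are atoms, the supply is \<sigma> minus \<tau>, and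
    the capacity of an edge is the \<psi>-measure of its rectangle.\<close>
  define s where "s v = measure \<sigma> (C v) - measure \<tau> (C v)" for v
  define c where "c u v = measure \<psi> (C u \<times> C v)" for u v
  have sum_s: "sum s S = measure \<sigma> (\<Union>v\<in>S. C v) - measure \<tau> (\<Union>v\<in>S. C v)" if "S \<subseteq> V" for S
  proof -
    have "finite S" using that finV by (rule finite_subset)
    then show ?thesis
      using that C_sets disj
      by (subst \<sigma>.finite_measure_finite_Union \<tau>.finite_measure_finite_Union;
          auto simp: s_def sum_subtractf \<sigma>(2) \<tau>(2))+
  qed
  have space_\<psi>: "space \<psi> = space J \<times> space J"
    using sets_eq_imp_space_eq[OF \<psi>(2)] by (simp add: space_pair_measure)
  obtain f where f: "\<And>u v. 0 \<le> f u v" "\<And>u v. f u v \<le> c u v"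
    and net: "\<And>v. v \<in> V \<Longrightarrow> (\<Sum>w\<in>V. f v w - f w v) = s v"
  proof (rule finite_feasible_flow[OF finV, of c s])
    show "0 \<le> c u v" for u v by (simp add: c_def)
    show "sum s V = 0" using sum_s[of V] total by (simp add: UN_V)
    \<comment> \<open>A vertex set \<open>S\<close> is the measurable set \<open>?U\<close>, and
      \<open>V - S\<close> is its complement, so the finite cut condition is the assumed one at
      \<open>?U\<close>.\<close>
    fix S assume S: "S \<subseteq> V"
    let ?U = "\<Union>v\<in>S. C v"
    have fin: "finite S" "finite (V - S)" using S finV by (auto intro: finite_subset)
    have U: "?U \<in> sets J" using S fin C_sets by auto
    have compl: "space J - ?U = (\<Union>v\<in>V - S. C v)"
      unfolding V_def C_def by (auto simp: mem_atom_of)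
    have "space \<psi> \<inter> ?U \<times> (space J - ?U) = ?U \<times> (space J - ?U)"
      using sets.sets_into_space[OF U] by (auto simp: space_\<psi>)
    then have "measure \<psi> (?U \<times> (space J - ?U)) = measure \<psi> (space \<psi> \<inter> ?U \<times> (space J - ?U))"
      by simp
    also have "\<dots> = (\<Sum>u\<in>S. \<Sum>v\<in>V - S. measure \<psi> (space \<psi> \<inter> C u \<times> C v))"
      unfolding compl using S fin disj C_sets
      by (intro measure_UN_times_UN[OF \<psi>]) auto
    also have "\<dots> = (\<Sum>u\<in>S. \<Sum>v\<in>V - S. c u v)"
      using S C_sets[THEN sets.sets_into_space] unfolding c_def
      by (intro sum.cong refl arg_cong[of _ _ "measure \<psi>"]) (auto simp: space_\<psi>)
    finally show "sum s S \<le> (\<Sum>u\<in>S. \<Sum>v\<in>V - S. c u v)"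
      using cut[OF U] sum_s[OF S] by simp
  qed blast
  define r where "r u v = f u v / c u v" for u v
  \<comment> \<open>The value 0 off \<open>sets \<psi>\<close> makes the bounds by
    \<open>measure \<psi>\<close> hold for every \<open>X\<close>, measurable or not.\<close>
  define \<phi> where "\<phi> X = (if X \<in> sets \<psi> then
      \<Sum>u\<in>V. \<Sum>v\<in>V. r u v * measure \<psi> (X \<inter> C u \<times> C v) else 0)" for X
  have CC_sets: "C u \<times> C v \<in> sets \<psi>" if "u \<in> V" "v \<in> V" for u v
    using C_sets that by (simp add: \<psi>(2))
  have ratio: "0 \<le> r u v" "r u v \<le> 1" "r u v * c u v = f u v" for u v
    using f[of u v] by (auto simp: r_def divide_le_eq_1)
  show thesis
  proof (rule that)
    show "0 \<le> \<phi> X" for X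
      using ratio(1) by (auto simp: \<phi>_def intro!: sum_nonneg mult_nonneg_nonneg)
    show "\<phi> X \<le> measure \<psi> X" for X
    proof (cases "X \<in> sets \<psi>")
      case True
      \<comment> \<open>All ratios are at most 1, and the rectangles partition the space.\<close>
      have "\<phi> X \<le> (\<Sum>u\<in>V. \<Sum>v\<in>V. measure \<psi> (X \<inter> C u \<times> C v))"
        using True ratio by (auto simp: \<phi>_def intro!: sum_mono mult_left_le_one_le)
      also have "\<dots> = measure \<psi> (X \<inter> space \<psi>)"
        unfolding space_\<psi> UN_V[symmetric] using finV disj C_sets True
        by (intro measure_UN_times_UN[OF \<psi>, symmetric]) auto
      finally show ?thesis using True by simp
    qed (simp add: \<phi>_def)
    show "set_additive \<psi> \<phi>"
      unfolding set_additive_def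
    proof (intro ballI impI)
      fix X Y assume XY: "X \<in> sets \<psi>" "Y \<in> sets \<psi>" "X \<inter> Y = {}"
      have "measure \<psi> ((X \<union> Y) \<inter> C u \<times> C v) = measure \<psi> (X \<inter> C u \<times> C v) + measure \<psi> (Y \<inter> C u \<times> C v)"
        if "u \<in> V" "v \<in> V" for u v
        unfolding Int_Un_distrib2 using XY CC_sets[OF that]
        by (intro \<psi>.finite_measure_Union) auto
      with XY show "\<phi> (X \<union> Y) = \<phi> X + \<phi> Y"
        by (simp add: \<phi>_def distrib_left sum.distrib)
    qed
  next
    fix A assume A: "A \<in> F"
    then have AJ: "A \<in> sets J" "A \<subseteq> space J"
      using F sets.sets_into_space by auto
    have C_sub: "C u \<subseteq> space J" for u by (auto simp: C_def mem_atom_of)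
    \<comment> \<open>Each atom lies inside \<open>A\<close> or misses it, so whole rectangles
      survive, and on a whole rectangle the spread-out flow adds up to \<open>f u v\<close>.\<close>
    have "A \<times> space J \<inter> C u \<times> C v = (if A \<in> u then C u \<times> C v else {})" for u v
      using A C_sub by (auto simp: C_def mem_atom_of)
    then have 1: "\<phi> (A \<times> space J) = (\<Sum>u\<in>V. \<Sum>v\<in>V. if A \<in> u then f u v else 0)"
      using AJ ratio(3) by (auto simp: \<phi>_def \<psi>(2) c_def intro!: sum.cong)
    have "space J \<times> A \<inter> C u \<times> C v = (if A \<in> v then C u \<times> C v else {})" for u v
      using A C_sub by (auto simp: C_def mem_atom_of)
    then have "\<phi> (space J \<times> A) = (\<Sum>u\<in>V. \<Sum>v\<in>V. if A \<in> v then f u v else 0)"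
      using AJ ratio(3) by (auto simp: \<phi>_def \<psi>(2) c_def intro!: sum.cong)
    \<comment> \<open>Renaming the inflow sum to the same outer vertex lets the difference collect
      the net outflow of each atom in \<open>A\<close>.\<close>
    also have "\<dots> = (\<Sum>u\<in>V. \<Sum>v\<in>V. if A \<in> u then f v u else 0)"
      by (rule sum.swap)
    finally have "\<phi> (A \<times> space J) - \<phi> (space J \<times> A)
        = (\<Sum>u\<in>V. if A \<in> u then (\<Sum>v\<in>V. f u v - f v u) else 0)"
      by (auto simp: 1 sum_subtractf[symmetric] intro!: sum.cong)
    also have "\<dots> = (\<Sum>u\<in>V. if A \<in> u then s u else 0)"
      using net by (intro sum.cong) auto
    also have "\<dots> = sum s {u \<in> V. A \<in> u}"
      using finV by (simp add: sum.inter_filter)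
    also have "\<dots> = measure \<sigma> A - measure \<tau> A"
      using sum_s[of "{u \<in> V. A \<in> u}"] UN_atom_of_eq[OF A AJ(2)] by (auto simp: V_def C_def)
    finally show "\<phi> (A \<times> space J) - \<phi> (space J \<times> A) = measure \<sigma> A - measure \<tau> A" .
  qed
qed

section \<open>From additive set functions to measures\<close>

text \<open>Along sets decreasing to the empty set \<open>measure \<psi>\<close> tends to 0, and by
  domination so does \<open>f\<close>. For a finite additive set function this continuity implies
  countable additivity.\<close>

lemma dominated_additive_is_measure:
  assumes "finite_measure \<psi>" and nonneg: "\<And>X. 0 \<le> f X" and le: "\<And>X. f X \<le> measure \<psi> X"
    and add: "set_additive \<psi> f"
  obtains \<phi> where "finite_measure \<phi>" "sets \<phi> = sets \<psi>" "\<And>X. X \<in> sets \<psi> \<Longrightarrow> measure \<phi> X = f X"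
proof -
  interpret \<psi>: finite_measure \<psi> by fact
  define \<phi> where "\<phi> = measure_of (space \<psi>) (sets \<psi>) (\<lambda>X. ennreal (f X))"
  have sets_\<phi>: "sets \<phi> = sets \<psi>" and space_\<phi>: "space \<phi> = space \<psi>"
    by (simp_all add: \<phi>_def)
  have empty: "f {} = 0"
    using nonneg[of "{}"] le[of "{}"] by simp
  have "countably_additive (sets \<psi>) (\<lambda>X. ennreal (f X))"
  proof (rule sets.empty_continuous_imp_countably_additive)
    show "positive (sets \<psi>) (\<lambda>X. ennreal (f X))"
      by (simp add: positive_def empty)
    show "additive (sets \<psi>) (\<lambda>X. ennreal (f X))"
      using add nonneg by (auto simp: additive_def set_additive_def ennreal_plus[symmetric] simp del: ennreal_plus)
    show "\<forall>A\<in>sets \<psi>. ennreal (f A) \<noteq> \<infinity>" by simp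
    fix A assume A: "range A \<subseteq> sets \<psi>" "decseq A" "(\<Inter>i. A i) = {}"
    have "(\<lambda>i. measure \<psi> (A i)) \<longlonglongrightarrow> 0"
      using \<psi>.finite_Lim_measure_decseq[OF A(1,2)] A(3) by simp
    then have "(\<lambda>i. f (A i)) \<longlonglongrightarrow> 0"
      by (rule tendsto_sandwich[rotated 3]) (auto simp: nonneg le)
    then show "(\<lambda>i. ennreal (f (A i))) \<longlonglongrightarrow> 0"
      using tendsto_ennrealI by fastforce
  qed
  then have emeasure_\<phi>: "emeasure \<phi> X = ennreal (f X)" if "X \<in> sets \<psi>" for X
    using that empty sets.space_closed
    by (intro emeasure_measure_of[OF \<phi>_def]) (auto simp: positive_def sets_\<phi>)
  show thesis
  proof (rule that[OF _ sets_\<phi>])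
    show "finite_measure \<phi>"
      by (rule finite_measureI) (simp add: space_\<phi> emeasure_\<phi>)
    show "measure \<phi> X = f X" if "X \<in> sets \<psi>" for X
      using emeasure_\<phi>[OF that] nonneg by (simp add: measure_def)
  qed
qed

section \<open>Necessity and sufficiency of the cut condition\<close>

text \<open>The mass on \<open>S \<times> S\<close> counts in both marginals and cancels; what flows
  back into \<open>S\<close> can only lower the net outflow.\<close>

lemma flow_le_cut:
  assumes \<phi>: "is_flow J \<sigma> \<tau> \<phi>" and S: "S \<in> sets J"
  shows "measure \<sigma> S - measure \<tau> S \<le> measure \<phi> (S \<times> (space J - S))"
proof -
  interpret finite_measure \<phi>
    using \<phi> by (simp add: is_flow_def finite_measure_on_def)
  have sets_\<phi>: "sets \<phi> = sets (J \<Otimes>\<^sub>M J)"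
    using \<phi> by (simp add: is_flow_def finite_measure_on_def)
  have "S \<times> space J = S \<times> S \<union> S \<times> (space J - S)"
    using sets.sets_into_space[OF S] by auto
  then have "measure \<phi> (S \<times> space J) = measure \<phi> (S \<times> S) + measure \<phi> (S \<times> (space J - S))"
    using S by (simp only:) (intro finite_measure_Union; auto simp: sets_\<phi>)
  moreover have "measure \<phi> (S \<times> S) \<le> measure \<phi> (space J \<times> S)"
    using S sets.sets_into_space[OF S] by (intro finite_measure_mono) (auto simp: sets_\<phi>)
  moreover have "measure \<phi> (S \<times> space J) - measure \<phi> (space J \<times> S) = measure \<sigma> S - measure \<tau> S"
    using \<phi> S by (simp add: is_flow_def marginal1_def marginal2_def)
  ultimately show ?thesis by linarith
qed

lemma flow_exists:
  assumes \<psi>: "finite_measure \<psi>" "sets \<psi> = sets (J \<Otimes>\<^sub>M J)"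
    and \<sigma>: "finite_measure \<sigma>" "sets \<sigma> = sets J"
    and \<tau>: "finite_measure \<tau>" "sets \<tau> = sets J"
    and total: "measure \<sigma> (space J) = measure \<tau> (space J)"
    and cut: "\<And>S. S \<in> sets J \<Longrightarrow> measure \<sigma> S - measure \<tau> S \<le> measure \<psi> (S \<times> (space J - S))"
  obtains \<phi> where "is_flow J \<sigma> \<tau> \<phi>" "\<And>X. X \<in> sets (J \<Otimes>\<^sub>M J) \<Longrightarrow> measure \<phi> X \<le> measure \<psi> X"
proof -
  \<comment> \<open>The bounds range over all sets \<open>X\<close>, so the first factor is a full
    box; additivity cuts out a closed part of it.\<close>
  define K where "K = {f. \<forall>X. 0 \<le> f X \<and> f X \<le> measure \<psi> X} \<inter> {f. set_additive \<psi> f}"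
  define D where "D A = {f :: ('a \<times> 'a) set \<Rightarrow> real.
      f (A \<times> space J) - f (space J \<times> A) = measure \<sigma> A - measure \<tau> A}" for A
  have "closed {f :: ('a \<times> 'a) set \<Rightarrow> real. f (X \<union> Y) = f X + f Y}" for X Y
    by (intro closed_Collect_eq continuous_on_add continuous_on_fun_apply)
  then have "closed {f. set_additive \<psi> f}"
    unfolding set_additive_def Ball_def
    by (intro closed_Collect_all closed_Collect_imp open_Collect_const)
  then have compact_K: "compact K"
    unfolding K_def by (intro compact_Int_closed compact_box_fun)
  have closed_D: "closed (D A)" for A
    unfolding D_def
    by (intro closed_Collect_eq continuous_on_diff continuous_on_const continuous_on_fun_apply)
  have fip: "K \<inter> (\<Inter>A\<in>F. D A) \<noteq> {}" if F: "finite F" "F \<subseteq> sets J" for F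
  proof (rule flow_on_finite_family[OF \<psi> \<sigma> \<tau> total cut F])
    fix f assume "\<And>X. 0 \<le> f X" "\<And>X. f X \<le> measure \<psi> X" "set_additive \<psi> f"
      "\<And>A. A \<in> F \<Longrightarrow> f (A \<times> space J) - f (space J \<times> A) = measure \<sigma> A - measure \<tau> A"
    then have "f \<in> K \<inter> (\<Inter>A\<in>F. D A)"
      by (simp add: K_def D_def)
    then show ?thesis by blast
  qed
  \<comment> \<open>Compactness passes from finite families to all of \<open>sets J\<close>, however
    large, giving one \<open>f\<close> with every marginal condition.\<close>
  have "K \<inter> (\<Inter>A\<in>sets J. D A) \<noteq> {}"
    by (rule compact_imp_fip_image[OF compact_K closed_D fip])
  then obtain f where f: "f \<in> K" "\<And>A. A \<in> sets J \<Longrightarrow> f \<in> D A"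
    by blast
  obtain \<phi> where \<phi>: "finite_measure \<phi>" "sets \<phi> = sets \<psi>" "\<And>X. X \<in> sets \<psi> \<Longrightarrow> measure \<phi> X = f X"
    using dominated_additive_is_measure[OF \<psi>(1), of f] f(1) by (auto simp: K_def)
  show thesis
  proof (rule that)
    show "is_flow J \<sigma> \<tau> \<phi>"
      using \<phi> f(2) by (simp add: is_flow_def finite_measure_on_def marginal1_def marginal2_def \<psi>(2) D_def)
    show "measure \<phi> X \<le> measure \<psi> X" if "X \<in> sets (J \<Otimes>\<^sub>M J)" for X
      using that \<phi>(3)[of X] f(1) by (simp add: \<psi>(2) K_def)
  qed
qed

theorem theorem4p11:
  fixes J \<sigma> \<tau> :: "'a measure" and \<psi> :: "('a \<times> 'a) measure"
  assumes "standard_borel J"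
    and "finite_measure_on (J \<Otimes>\<^sub>M J) \<psi>"
    and "finite_measure_on J \<sigma>"
    and "finite_measure_on J \<tau>"
    and "measure \<sigma> (space J) = measure \<tau> (space J)"
  shows "(\<exists>\<phi>. is_flow J \<sigma> \<tau> \<phi> \<and> (\<forall>X\<in>sets (J \<Otimes>\<^sub>M J). measure \<phi> X \<le> measure \<psi> X)) \<longleftrightarrow>
    (\<forall>S\<in>sets J. measure \<psi> (S \<times> (space J - S)) \<ge> measure \<sigma> S - measure \<tau> S)"
proof
  assume "\<exists>\<phi>. is_flow J \<sigma> \<tau> \<phi> \<and> (\<forall>X\<in>sets (J \<Otimes>\<^sub>M J). measure \<phi> X \<le> measure \<psi> X)"
  then obtain \<phi> where \<phi>: "is_flow J \<sigma> \<tau> \<phi>" "\<forall>X\<in>sets (J \<Otimes>\<^sub>M J). measure \<phi> X \<le> measure \<psi> X"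
    by blast
  show "\<forall>S\<in>sets J. measure \<psi> (S \<times> (space J - S)) \<ge> measure \<sigma> S - measure \<tau> S"
  proof
    fix S assume S: "S \<in> sets J"
    then have "S \<times> (space J - S) \<in> sets (J \<Otimes>\<^sub>M J)" by auto
    with \<phi>(2) flow_le_cut[OF \<phi>(1) S]
    show "measure \<psi> (S \<times> (space J - S)) \<ge> measure \<sigma> S - measure \<tau> S"
      by (meson order_trans)
  qed
next
  assume "\<forall>S\<in>sets J. measure \<psi> (S \<times> (space J - S)) \<ge> measure \<sigma> S - measure \<tau> S"
  then show "\<exists>\<phi>. is_flow J \<sigma> \<tau> \<phi> \<and> (\<forall>X\<in>sets (J \<Otimes>\<^sub>M J). measure \<phi> X \<le> measure \<psi> X)"
    using assms(2-5) flow_exists[of \<psi> J \<sigma> \<tau>] unfolding finite_measure_on_def by metis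
qed

end
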